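(* Let $\mathcal{A}=\{A_1,\dots,A_n\}$ be disjoint regions of $\partial M$, with multipartite cross section $E_w(\mathcal{A})$. Then $$E_w(\mathcal{A})\ge I(\mathcal{A}):=\sum_iS(A_i)-S(A_1\cdots A_n).$$
   Context: $M$ is a Riemannian manifold with boundary (compact, after a cutoff if necessary). For a boundary region $R\subset\partial M$, $S(R)$ is the minimal area of a hypersurface in $M$ homologous to $R$ (Ryu–Takayanagi formula), and $S(A_1\cdots A_n)=S(A_1\cup\dots\cup A_n)$. $m(\mathcal{A})$ is the minimal hypersurface in $M$ homologous to $A_1\cup\dots\cup A_n$ (assumed unique), $\mathcal{O}:=m(\mathcal{A})$, and $r(\mathcal{A})$ is the region of $M$ bounded by $A_1\cup\dots\cup A_n$ and $\mathcal{O}$. For a partition of $\mathcal{O}$ into non-overlapping regions $A_1',\dots,A_n'$ (one for each $i$, possibly empty), $m(A_iA_i')$ is the minimal hypersurface in $r(\mathcal{A})$ homologous to $A_i\cup A_i'$, and $$E_w(\mathcal{A}):=\min_{\{A_i'\}\text{ partition of }\mathcal{O}}\ \sum_i\operatorname{area}(m(A_iA_i')).$$ Minima are read as infima if not attained. Standing assumption: $E_w(\mathcal{A})$ also equals the optimal value of its convex relaxation, i.e. the infimum of $\sum_i\int_{r(\mathcal{A})}\sqrt g\,|\nabla\psi_i|$ over real functions $\psi_i$ on $r(\mathcal{A})$ with $\psi_i|_{A_j}=\delta_{ij}$ and $\sum_i\psi_i|_{\mathcal{O}}=1$. *)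

theory Defs
  imports "HOL-Analysis.Analysis"
begin

section \<open>Smooth maps on subsets of Euclidean space\<close>

primrec Ck_on :: "nat \<Rightarrow> (real^'n) set \<Rightarrow> (real^'n \<Rightarrow> 'b::real_normed_vector) \<Rightarrow> bool" where
  "Ck_on 0 U f \<longleftrightarrow> continuous_on U f"
| "Ck_on (Suc k) U f \<longleftrightarrow>
     (\<forall>x\<in>U. f differentiable (at x)) \<and> (\<forall>v. Ck_on k U (\<lambda>x. frechet_derivative f (at x) v))"

text \<open>On a set that need not be open (a relatively open part of a half space), smoothness means
  local extendability to a smooth function on an open set.\<close>

definition smooth_map_on :: "(real^'n) set \<Rightarrow> (real^'n \<Rightarrow> 'b::real_normed_vector) \<Rightarrow> bool" where
  "smooth_map_on S f \<longleftrightarrow>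
     (\<forall>x\<in>S. \<exists>V h. open V \<and> x \<in> V \<and> (\<forall>k. Ck_on k V h) \<and> (\<forall>y\<in>V \<inter> S. h y = f y))"


section \<open>Riemannian manifolds with boundary\<close>

definition normal_coord :: "'n::finite" where
  "normal_coord = (SOME k. True)"

definition half_space :: "(real^'n) set" where
  "half_space = {x. 0 \<le> x $ normal_coord}"

type_synonym ('a, 'n) chart = "'a set \<times> ('a \<Rightarrow> real^'n)"

text \<open>A chart is a pair of its domain and its coordinate map; \<open>metric M c x\<close> is the matrix
  $(g_{ij}(x))$ of the metric in the chart \<open>c\<close> at the coordinate point \<open>x\<close>.\<close>

record ('a, 'n) rmanifold =
  points :: "'a set"
  charts :: "('a, 'n) chart set"
  metric :: "('a, 'n) chart \<Rightarrow> real^'n \<Rightarrow> real^'n^'n"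

definition smooth_atlas :: "('a::metric_space, 'n::finite) rmanifold \<Rightarrow> bool" where
  "smooth_atlas M \<longleftrightarrow>
     (\<Union>(U, \<phi>)\<in>charts M. U) = points M \<and>
     (\<forall>(U, \<phi>)\<in>charts M.
        openin (top_of_set (points M)) U \<and>
        openin (top_of_set half_space) (\<phi> ` U) \<and>
        homeomorphism U (\<phi> ` U) \<phi> (inv_into U \<phi>)) \<and>
     (\<forall>(U, \<phi>)\<in>charts M. \<forall>(V, \<theta>)\<in>charts M.
        smooth_map_on (\<phi> ` (U \<inter> V)) (\<theta> \<circ> inv_into U \<phi>))"

definition riemannian_metric :: "('a::metric_space, 'n::finite) rmanifold \<Rightarrow> bool" where
  "riemannian_metric M \<longleftrightarrow>
     (\<forall>(U, \<phi>)\<in>charts M.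
        smooth_map_on (\<phi> ` U) (metric M (U, \<phi>)) \<and>
        (\<forall>x\<in>\<phi> ` U. transpose (metric M (U, \<phi>) x) = metric M (U, \<phi>) x \<and>
           (\<forall>v. v \<noteq> 0 \<longrightarrow> 0 < v \<bullet> (metric M (U, \<phi>) x *v v)))) \<and>
     (\<forall>(U, \<phi>)\<in>charts M. \<forall>(V, \<theta>)\<in>charts M. \<forall>x\<in>\<phi> ` (U \<inter> V). \<forall>J.
        ((\<theta> \<circ> inv_into U \<phi>) has_derivative (\<lambda>h. J *v h)) (at x within \<phi> ` (U \<inter> V)) \<longrightarrow>
        metric M (U, \<phi>) x = transpose J ** metric M (V, \<theta>) ((\<theta> \<circ> inv_into U \<phi>) x) ** J)"

definition speed :: "('a::metric_space, 'n::finite) rmanifold \<Rightarrow> (real \<Rightarrow> 'a) \<Rightarrow> real \<Rightarrow> real" where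
  "speed M \<gamma> t =
     (let c = (SOME c. c \<in> charts M \<and> \<gamma> t \<in> fst c);
          v = vector_derivative (snd c \<circ> \<gamma>) (at t)
      in sqrt (v \<bullet> (metric M c (snd c (\<gamma> t)) *v v)))"

definition piecewise_C1_curve :: "('a::metric_space, 'n::finite) rmanifold \<Rightarrow> (real \<Rightarrow> 'a) \<Rightarrow> bool" where
  "piecewise_C1_curve M \<gamma> \<longleftrightarrow>
     path \<gamma> \<and> path_image \<gamma> \<subseteq> points M \<and>
     (\<forall>t\<in>{0..1}. \<forall>(U, \<phi>)\<in>charts M. \<gamma> t \<in> U \<longrightarrow>
        (\<exists>\<epsilon>>0. \<gamma> ` ({0..1} \<inter> {t-\<epsilon>..t+\<epsilon>}) \<subseteq> U \<and>
               (\<phi> \<circ> \<gamma>) piecewise_C1_differentiable_on ({0..1} \<inter> {t-\<epsilon>..t+\<epsilon>})))"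

definition curve_length :: "('a::metric_space, 'n::finite) rmanifold \<Rightarrow> (real \<Rightarrow> 'a) \<Rightarrow> ennreal" where
  "curve_length M \<gamma> = (\<integral>\<^sup>+t\<in>{0..1}. ennreal (speed M \<gamma> t) \<partial>lborel)"

text \<open>The value is \<open>\<infinity>\<close> for points in different components.\<close>

definition riemannian_dist :: "('a::metric_space, 'n::finite) rmanifold \<Rightarrow> 'a \<Rightarrow> 'a \<Rightarrow> ennreal" where
  "riemannian_dist M p q =
     (INF \<gamma>\<in>{\<gamma>. piecewise_C1_curve M \<gamma> \<and> pathstart \<gamma> = p \<and> pathfinish \<gamma> = q}. curve_length M \<gamma>)"

text \<open>The last clause says that the distance of the ambient type is the Riemannian distance on each
  component of the manifold. It is no restriction: the Riemannian distance induces the manifold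
  topology, and a compact manifold has finitely many components, whose mutual distances may be set
  to a large constant. Its purpose is that \<open>dist\<close> and \<open>diameter\<close> can be used to measure
  hypersurfaces.\<close>

definition compact_riemannian_manifold :: "('a::metric_space, 'n::finite) rmanifold \<Rightarrow> bool" where
  "compact_riemannian_manifold M \<longleftrightarrow>
     compact (points M) \<and> smooth_atlas M \<and> riemannian_metric M \<and>
     (\<forall>p\<in>points M. \<forall>q\<in>points M.
        riemannian_dist M p q < \<infinity> \<longrightarrow> ennreal (dist p q) = riemannian_dist M p q)"

definition boundary :: "('a::metric_space, 'n::finite) rmanifold \<Rightarrow> 'a set" where
  "boundary M = {p. \<exists>(U, \<phi>)\<in>charts M. p \<in> U \<and> \<phi> p $ normal_coord = 0}"


section \<open>Area\<close>

text \<open>Hausdorff measure of integer dimension \<open>k\<close>, normalised to agree with the Riemannian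
  \<open>k\<close>-dimensional volume of smooth submanifolds.\<close>

definition hausdorff_content :: "nat \<Rightarrow> real \<Rightarrow> 'a::metric_space set \<Rightarrow> ennreal" where
  "hausdorff_content k \<delta> X =
     (INF C\<in>{C :: nat \<Rightarrow> 'a set. X \<subseteq> (\<Union>i. C i) \<and> (\<forall>i. bounded (C i) \<and> diameter (C i) \<le> \<delta>)}.
        \<Sum>i. if C i = {} then 0 else ennreal (unit_ball_vol (real k) * (diameter (C i) / 2) ^ k))"

definition hausdorff_measure :: "nat \<Rightarrow> 'a::metric_space set \<Rightarrow> ennreal" where
  "hausdorff_measure k X = (SUP \<delta>\<in>{0<..}. hausdorff_content k \<delta> X)"

definition area :: "('a::metric_space, 'n::finite) rmanifold \<Rightarrow> 'a set \<Rightarrow> ennreal" where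
  "area M X = hausdorff_measure (CARD('n) - 1) X"


section \<open>Regions, homology and minimal hypersurfaces\<close>

text \<open>A region of the manifold, and its boundary as a codimension-0 piece of the manifold: besides the
  topological frontier, this contains the part of the region lying on the boundary of the manifold.\<close>

definition region :: "('a::metric_space, 'n::finite) rmanifold \<Rightarrow> 'a set \<Rightarrow> bool" where
  "region M s \<longleftrightarrow> s \<subseteq> points M \<and>
     (top_of_set (points M)) closure_of ((top_of_set (points M)) interior_of s) = s"

definition region_boundary :: "('a::metric_space, 'n::finite) rmanifold \<Rightarrow> 'a set \<Rightarrow> 'a set" where
  "region_boundary M s = (top_of_set (points M)) frontier_of s \<union> (s \<inter> boundary M)"

text \<open>A region of a hypersurface \<open>X\<close> (such as the boundary of the manifold). It need not be
  closed in \<open>X\<close>, so that adjacent regions can be disjoint as sets.\<close>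

definition region_of :: "('a::metric_space, 'n::finite) rmanifold \<Rightarrow> 'a set \<Rightarrow> 'a set \<Rightarrow> bool" where
  "region_of M X R \<longleftrightarrow> R \<subseteq> X \<and>
     R \<subseteq> (top_of_set X) closure_of ((top_of_set X) interior_of R) \<and>
     area M ((top_of_set X) frontier_of R) = 0"

text \<open>\<open>m\<close> is homologous to \<open>R\<close> within \<open>N\<close> through \<open>s\<close> if the region \<open>s\<close> of \<open>N\<close> is bounded by \<open>m\<close>
  and \<open>R\<close>: the boundary of \<open>s\<close> is their sum modulo 2. If \<open>m\<close> and \<open>R\<close> are disjoint this is their
  union; the sum also allows \<open>m\<close> to run along \<open>R\<close> (for instance \<open>m = R\<close> with \<open>s\<close> empty), where the
  region between them degenerates.\<close>

definition bounded_by ::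
    "('a::metric_space, 'n::finite) rmanifold \<Rightarrow> 'a set \<Rightarrow> 'a set \<Rightarrow> 'a set \<Rightarrow> bool" where
  "bounded_by M s R m \<longleftrightarrow> region M s \<and> region_boundary M s = sym_diff R m"

definition homologous ::
    "('a::metric_space, 'n::finite) rmanifold \<Rightarrow> 'a set \<Rightarrow> 'a set \<Rightarrow> 'a set \<Rightarrow> bool" where
  "homologous M N R m \<longleftrightarrow> (\<exists>s\<subseteq>N. bounded_by M s R m)"

definition min_area :: "('a::metric_space, 'n::finite) rmanifold \<Rightarrow> 'a set \<Rightarrow> 'a set \<Rightarrow> ennreal" where
  "min_area M N R = (INF m\<in>{m. homologous M N R m}. area M m)"

definition minimal_hypersurface ::
    "('a::metric_space, 'n::finite) rmanifold \<Rightarrow> 'a set \<Rightarrow> 'a set \<Rightarrow> 'a set \<Rightarrow> bool" where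
  "minimal_hypersurface M N R m \<longleftrightarrow> homologous M N R m \<and> area M m = min_area M N R"

definition RT_entropy :: "('a::metric_space, 'n::finite) rmanifold \<Rightarrow> 'a set \<Rightarrow> ennreal" where
  "RT_entropy M R = min_area M (points M) R"

definition multi_information ::
    "('a::metric_space, 'n::finite) rmanifold \<Rightarrow> nat \<Rightarrow> (nat \<Rightarrow> 'a set) \<Rightarrow> ereal" where
  "multi_information M n A =
     (\<Sum>i\<in>{1..n}. enn2ereal (RT_entropy M (A i))) - enn2ereal (RT_entropy M (\<Union>i\<in>{1..n}. A i))"


section \<open>The multipartite cross section\<close>

definition region_partition ::
    "('a::metric_space, 'n::finite) rmanifold \<Rightarrow> nat \<Rightarrow> 'a set \<Rightarrow> (nat \<Rightarrow> 'a set) \<Rightarrow> bool" where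
  "region_partition M n X A' \<longleftrightarrow>
     (\<forall>i\<in>{1..n}. region_of M X (A' i)) \<and> (\<Union>i\<in>{1..n}. A' i) = X \<and>
     disjoint_family_on (\<lambda>i. (top_of_set X) interior_of (A' i)) {1..n}"

text \<open>Here \<open>r\<close> and \<open>X\<close> stand for $r(\mathcal{A})$ and $\mathcal{O}$. The surface $A_i A_i'$ is the
  sum of its two pieces modulo 2, as in \<open>bounded_by\<close>. It is their union except where
  $\mathcal{O}$ runs along $A_i$; there \<open>r\<close> has no thickness, the two faces cancel, and nothing is
  needed to separate them from the other regions.\<close>

definition cross_section ::
    "('a::metric_space, 'n::finite) rmanifold \<Rightarrow> nat \<Rightarrow> (nat \<Rightarrow> 'a set) \<Rightarrow> 'a set \<Rightarrow> 'a set \<Rightarrow> ennreal" where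
  "cross_section M n A r X =
     (INF A'\<in>{A'. region_partition M n X A'}. \<Sum>i\<in>{1..n}. min_area M r (sym_diff (A i) (A' i)))"


section \<open>The convex relaxation\<close>

text \<open>$\int_B \sqrt{g}\,f$ for nonnegative \<open>f\<close>, where \<open>f c x\<close> is the integrand at the point with
  coordinates \<open>x\<close> in the chart \<open>c\<close>: cut \<open>B\<close> into finitely many Borel pieces lying in
  chart domains. The supremum is attained when the pieces cover \<open>B\<close>.\<close>

definition riemannian_integral ::
    "('a::metric_space, 'n::finite) rmanifold \<Rightarrow> 'a set \<Rightarrow> (('a, 'n) chart \<Rightarrow> real^'n \<Rightarrow> real) \<Rightarrow> ennreal" where
  "riemannian_integral M B f =
     (SUP (m, c, P)\<in>{(m :: nat, c, P). disjoint_family_on P {..<m} \<and>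
          (\<forall>k<m. c k \<in> charts M \<and> P k \<in> sets borel \<and> P k \<subseteq> B \<inter> fst (c k))}.
        \<Sum>k<m. \<integral>\<^sup>+x\<in>snd (c k) ` P k. ennreal (sqrt (det (metric M (c k) x)) * f (c k) x) \<partial>lborel)"

text \<open>$|\nabla\psi| = \sqrt{g^{ij}\,\partial_i\psi\,\partial_j\psi}$\<close>

definition grad_norm ::
    "('a::metric_space, 'n::finite) rmanifold \<Rightarrow> ('a \<Rightarrow> real) \<Rightarrow> ('a, 'n) chart \<Rightarrow> real^'n \<Rightarrow> real" where
  "grad_norm M \<psi> c x =
     (let d = (\<chi> i. frechet_derivative (\<psi> \<circ> inv_into (fst c) (snd c)) (at x) (axis i 1))
      in sqrt (d \<bullet> (matrix_inv (metric M c x) *v d)))"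

definition bulk :: "('a::metric_space, 'n::finite) rmanifold \<Rightarrow> 'a set \<Rightarrow> 'a set" where
  "bulk M r = (top_of_set (points M)) interior_of r - boundary M"

text \<open>The functions are continuously differentiable inside \<open>r\<close> and take their boundary values as
  limits from inside, except on sets of zero area. Exceptional points must be allowed because no
  continuous function takes the prescribed values where two adjacent regions $A_i$, $A_j$ meet.\<close>

definition relaxation_feasible ::
    "('a::metric_space, 'n::finite) rmanifold \<Rightarrow> nat \<Rightarrow> (nat \<Rightarrow> 'a set) \<Rightarrow> 'a set \<Rightarrow> 'a set
      \<Rightarrow> (nat \<Rightarrow> 'a \<Rightarrow> real) \<Rightarrow> bool" where
  "relaxation_feasible M n A r X \<psi> \<longleftrightarrow>
     (\<forall>i\<in>{1..n}. \<forall>(U, \<phi>)\<in>charts M. Ck_on 1 (\<phi> ` (U \<inter> bulk M r)) (\<psi> i \<circ> inv_into U \<phi>)) \<and>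
     (\<forall>i\<in>{1..n}. \<forall>j\<in>{1..n}.
        area M {p \<in> A j \<inter> r. \<not> (\<psi> i \<longlongrightarrow> (if i = j then 1 else 0)) (at p within bulk M r)} = 0) \<and>
     area M {p \<in> X \<inter> r. \<not> ((\<lambda>q. \<Sum>i\<in>{1..n}. \<psi> i q) \<longlongrightarrow> 1) (at p within bulk M r)} = 0"

definition relaxed_cross_section ::
    "('a::metric_space, 'n::finite) rmanifold \<Rightarrow> nat \<Rightarrow> (nat \<Rightarrow> 'a set) \<Rightarrow> 'a set \<Rightarrow> 'a set \<Rightarrow> ennreal" where
  "relaxed_cross_section M n A r X =
     (INF \<psi>\<in>{\<psi>. relaxation_feasible M n A r X \<psi>}.
        \<Sum>i\<in>{1..n}. riemannian_integral M (bulk M r) (grad_norm M (\<psi> i)))"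

end

(* If s is bounded by A_i, A_i' and m, then s also shows that A_i' + m is homologous to A_i, so that
   S(A_i) <= area A_i' + area m. Summing over i, the areas of the A_i' add up to at most the area of
   the minimal hypersurface. The additivity of the area used here is Caratheodory's theorem that open
   sets split metric outer measures. It remains to exclude infinite areas, for which subtraction of
   extended reals is no inverse of addition: if every hypersurface homologous to the union of the A_i
   had infinite area, they would all be minimal, and uniqueness would force the boundary of M to be
   empty. *)

theory Submission
  imports Defs
begin

section \<open>Hausdorff measure as a metric outer measure\<close>

text \<open>The case distinction matters only for \<open>k = 0\<close>, where the power is 1 even
  for the empty set. It allows any cover to be padded with empty sets free of charge.\<close>

definition covering_cost :: "nat \<Rightarrow> 'a::metric_space set \<Rightarrow> ennreal" where
  "covering_cost k S =
     (if S = {} then 0 else ennreal (unit_ball_vol (real k) * (diameter S / 2) ^ k))"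

text \<open>Boundedness is a separate condition because \<open>diameter\<close> is an unspecified
  supremum on unbounded sets.\<close>

definition fine_cover :: "real \<Rightarrow> 'a::metric_space set \<Rightarrow> (nat \<Rightarrow> 'a set) \<Rightarrow> bool" where
  "fine_cover \<delta> X C \<longleftrightarrow> X \<subseteq> (\<Union>i. C i) \<and> (\<forall>i. bounded (C i) \<and> diameter (C i) \<le> \<delta>)"

lemma hausdorff_content_alt:
  "hausdorff_content k \<delta> X = (INF C\<in>{C. fine_cover \<delta> X C}. \<Sum>i. covering_cost k (C i))"
  by (simp add: hausdorff_content_def covering_cost_def fine_cover_def)

lemma hausdorff_content_le:
  "fine_cover \<delta> X C \<Longrightarrow> hausdorff_content k \<delta> X \<le> (\<Sum>i. covering_cost k (C i))"
  unfolding hausdorff_content_alt by (rule INF_lower) simp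

lemma fine_cover_mono:
  assumes "fine_cover \<delta> Y C" and "X \<subseteq> Y" and "\<delta> \<le> \<epsilon>"
  shows "fine_cover \<epsilon> X C"
  using assms order_trans[of X Y "\<Union>i. C i"] order_trans[of "diameter (C i)" \<delta> \<epsilon> for i]
  by (simp add: fine_cover_def)

lemma hausdorff_content_mono:
  assumes "X \<subseteq> Y" and "\<delta> \<le> \<epsilon>"
  shows "hausdorff_content k \<epsilon> X \<le> hausdorff_content k \<delta> Y"
  unfolding hausdorff_content_alt
  by (rule INF_superset_mono) (simp_all add: Collect_mono fine_cover_mono[OF _ assms])

lemma hausdorff_content_le_measure:
  "\<delta> > 0 \<Longrightarrow> hausdorff_content k \<delta> X \<le> hausdorff_measure k X"
  unfolding hausdorff_measure_def by (rule SUP_upper) simp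

lemma hausdorff_measure_mono:
  "X \<subseteq> Y \<Longrightarrow> hausdorff_measure k X \<le> hausdorff_measure k Y"
  unfolding hausdorff_measure_def by (rule SUP_mono') (simp add: hausdorff_content_mono)

lemma hausdorff_measure_empty [simp]: "hausdorff_measure k {} = 0"
proof -
  have "hausdorff_content k \<delta> {} = 0" if "\<delta> > 0" for \<delta>
    using hausdorff_content_le[of \<delta> "{}" "\<lambda>_. {}" k] that
    by (simp add: fine_cover_def covering_cost_def)
  then have "hausdorff_measure k {} \<le> 0"
    unfolding hausdorff_measure_def by (intro SUP_least) simp
  then show ?thesis by simp
qed

section \<open>Countable subadditivity\<close>

text \<open>Near-optimal covers of the single sets, with errors forming a geometric series of total
  \<open>e\<close>, merge into one cover of the union.\<close>

lemma hausdorff_content_UN_le: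
  "hausdorff_content k \<delta> (\<Union>n::nat. X n) \<le> (\<Sum>n. hausdorff_content k \<delta> (X n))"
proof (rule ennreal_le_epsilon)
  fix e :: real
  assume fin: "(\<Sum>n. hausdorff_content k \<delta> (X n)) < top" and e: "0 < e"
  define a where "a n = ennreal (e * (1/2)^Suc n)" for n
  have a_pos: "a n > 0" for n
    using e by (simp add: a_def)
  have "\<exists>C. fine_cover \<delta> (X n) C \<and>
      (\<Sum>i. covering_cost k (C i)) \<le> hausdorff_content k \<delta> (X n) + a n" for n
  proof -
    \<comment> \<open>Finiteness makes adding \<open>a n\<close> a strict increase, so some cover
      lies below the increased value.\<close>
    have "hausdorff_content k \<delta> (X n) < top"
      using fin by (rule ennreal_suminf_lessD)
    then have "hausdorff_content k \<delta> (X n) < hausdorff_content k \<delta> (X n) + a n"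
      using a_pos[of n] ennreal_add_left_cancel_less[of "hausdorff_content k \<delta> (X n)" 0 "a n"]
      by (simp add: less_top)
    then show ?thesis
      unfolding hausdorff_content_alt INF_less_iff by (auto intro: less_imp_le)
  qed
  then obtain C where C: "\<And>n. fine_cover \<delta> (X n) (C n)"
      "\<And>n. (\<Sum>i. covering_cost k (C n i)) \<le> hausdorff_content k \<delta> (X n) + a n"
    by metis
  \<comment> \<open>The double sequence of covering sets is enumerated as a single one along the
    pairing bijection.\<close>
  let ?D = "\<lambda>i. case_prod C (prod_decode i)"
  have "fine_cover \<delta> (\<Union>n. X n) ?D"
    unfolding fine_cover_def
  proof (intro conjI allI)
    show "(\<Union>n. X n) \<subseteq> (\<Union>i. ?D i)"
    proof
      fix x assume "x \<in> (\<Union>n. X n)"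
      then obtain n i where "x \<in> C n i"
        using C(1) by (fastforce simp: fine_cover_def)
      then have "x \<in> ?D (prod_encode (n, i))" by simp
      then show "x \<in> (\<Union>i. ?D i)" by (rule UN_I[OF UNIV_I])
    qed
  qed (use C(1) in \<open>auto simp: fine_cover_def split: prod.split\<close>)
  then have "hausdorff_content k \<delta> (\<Union>n. X n) \<le> (\<Sum>i. covering_cost k (?D i))"
    by (rule hausdorff_content_le)
  also have "\<dots> = (\<Sum>n. \<Sum>i. covering_cost k (C n i))"
    using suminf_ennreal_2dimen[of "\<lambda>n. \<Sum>i. covering_cost k (C n i)"
        "\<lambda>p. covering_cost k (case_prod C p)"] by simp
  also have "\<dots> \<le> (\<Sum>n. hausdorff_content k \<delta> (X n) + a n)"
    by (intro suminf_le C(2)) auto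
  also have "\<dots> = (\<Sum>n. hausdorff_content k \<delta> (X n)) + (\<Sum>n. a n)"
    by (rule suminf_add[symmetric]) auto
  also have "(\<Sum>n. a n) = ennreal e"
    unfolding a_def using e sums_mult[OF power_half_series, of e]
    by (intro suminf_ennreal_eq) auto
  finally show "hausdorff_content k \<delta> (\<Union>n. X n)
      \<le> (\<Sum>n. hausdorff_content k \<delta> (X n)) + ennreal e" .
qed

lemma hausdorff_measure_UN_le:
  "hausdorff_measure k (\<Union>n::nat. X n) \<le> (\<Sum>n. hausdorff_measure k (X n))"
proof -
  have "hausdorff_content k \<delta> (\<Union>n. X n) \<le> (\<Sum>n. hausdorff_measure k (X n))" if "\<delta> > 0" for \<delta>
    by (rule order_trans[OF hausdorff_content_UN_le])
      (intro suminf_le hausdorff_content_le_measure that, auto)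
  then show ?thesis
    unfolding hausdorff_measure_def[of k "\<Union>n. X n"] by (intro SUP_least) auto
qed

lemma hausdorff_measure_Un_le:
  "hausdorff_measure k (X \<union> Y) \<le> hausdorff_measure k X + hausdorff_measure k Y"
proof -
  let ?Z = "\<lambda>n::nat. if n = 0 then X else if n = 1 then Y else {}"
  have "(\<Union>n. ?Z n) = X \<union> Y" by (auto split: if_splits)
  moreover have "(\<Sum>n. hausdorff_measure k (?Z n)) = (\<Sum>n\<in>{0,1}. hausdorff_measure k (?Z n))"
    by (rule suminf_finite) auto
  ultimately show ?thesis
    using hausdorff_measure_UN_le[of k ?Z] by simp
qed

section \<open>Additivity over separated sets and splitting by open sets\<close>

text \<open>A set of diameter less than \<open>d\<close> cannot meet both \<open>X\<close> and
  \<open>Y\<close>, so a fine enough cover of the union splits into disjoint subfamilies covering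
  \<open>X\<close> and \<open>Y\<close>.\<close>

lemma hausdorff_measure_separated:
  assumes d: "d > 0" and sep: "\<And>x y. x \<in> X \<Longrightarrow> y \<in> Y \<Longrightarrow> d \<le> dist x y"
  shows "hausdorff_measure k X + hausdorff_measure k Y \<le> hausdorff_measure k (X \<union> Y)"
proof -
  have small: "hausdorff_content k \<delta> X + hausdorff_content k \<delta> Y \<le> hausdorff_content k \<delta> (X \<union> Y)"
    if "0 < \<delta>" "\<delta> < d" for \<delta>
    unfolding hausdorff_content_alt[of k \<delta> "X \<union> Y"]
  proof (rule INF_greatest)
    fix C assume "C \<in> {C. fine_cover \<delta> (X \<union> Y) C}"
    then have C: "X \<union> Y \<subseteq> (\<Union>i. C i)" "\<And>i. bounded (C i)" "\<And>i. diameter (C i) \<le> \<delta>"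
      by (auto simp: fine_cover_def)
    let ?P = "\<lambda>Z i. if C i \<inter> Z = {} then {} else C i"
    have cov: "fine_cover \<delta> Z (?P Z)" if Z: "Z \<subseteq> X \<union> Y" for Z
      unfolding fine_cover_def
    proof (intro conjI allI subsetI)
      fix x assume "x \<in> Z"
      then obtain i where "x \<in> C i" using Z C(1) by blast
      then have "x \<in> ?P Z i" using \<open>x \<in> Z\<close> by auto
      then show "x \<in> (\<Union>i. ?P Z i)" by (rule UN_I[OF UNIV_I])
    qed (use C \<open>0 < \<delta>\<close> in auto)
    have disj: "C i \<inter> X = {} \<or> C i \<inter> Y = {}" for i
    proof (rule ccontr)
      assume "\<not> ?thesis"
      then obtain x y where "x \<in> C i" "x \<in> X" "y \<in> C i" "y \<in> Y" by blast
      then show False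
        using sep[of x y] diameter_bounded_bound[OF C(2), of x i y] C(3)[of i] that by simp
    qed
    have "hausdorff_content k \<delta> X + hausdorff_content k \<delta> Y
        \<le> (\<Sum>i. covering_cost k (?P X i)) + (\<Sum>i. covering_cost k (?P Y i))"
      by (intro add_mono hausdorff_content_le cov) auto
    also have "\<dots> = (\<Sum>i. covering_cost k (?P X i) + covering_cost k (?P Y i))"
      by (rule suminf_add) auto
    also have "\<dots> \<le> (\<Sum>i. covering_cost k (C i))"
      using disj by (intro suminf_le) (auto simp: covering_cost_def)
    finally show "hausdorff_content k \<delta> X + hausdorff_content k \<delta> Y
        \<le> (\<Sum>i. covering_cost k (C i))" .
  qed
  \<comment> \<open>The two suprema run over independent scales. Contents grow as the scale shrinks,
    so both can be compared at one common scale; \<open>d / 2\<close> keeps it strictly below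
    \<open>d\<close>.\<close>
  have le: "hausdorff_content k \<delta> X + hausdorff_content k \<epsilon> Y \<le> hausdorff_measure k (X \<union> Y)"
    if "\<delta> > 0" "\<epsilon> > 0" for \<delta> \<epsilon>
  proof -
    define \<eta> where "\<eta> = min (min \<delta> \<epsilon>) (d / 2)"
    have \<eta>: "0 < \<eta>" "\<eta> < d" "\<eta> \<le> \<delta>" "\<eta> \<le> \<epsilon>"
      using that d by (auto simp: \<eta>_def min_def)
    have "hausdorff_content k \<delta> X + hausdorff_content k \<epsilon> Y
        \<le> hausdorff_content k \<eta> X + hausdorff_content k \<eta> Y"
      by (intro add_mono hausdorff_content_mono order_refl \<eta>)
    also have "\<dots> \<le> hausdorff_content k \<eta> (X \<union> Y)"
      by (rule small[OF \<eta>(1,2)])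
    also have "\<dots> \<le> hausdorff_measure k (X \<union> Y)"
      by (rule hausdorff_content_le_measure[OF \<eta>(1)])
    finally show ?thesis .
  qed
  have ne: "{0::real<..} \<noteq> {}" by (auto intro: exI[of _ 1])
  show ?thesis
    unfolding hausdorff_measure_def[of k X] hausdorff_measure_def[of k Y]
      ennreal_SUP_add_left[OF ne, symmetric] ennreal_SUP_add_right[OF ne]
    by (intro SUP_least) (simp add: le)
qed

text \<open>\<open>E \<inter> U\<close> is exhausted by the sets \<open>core N\<close>, which have
  positive distance from \<open>E - U\<close>. What a core misses is a tail of thin shells near the
  complement of \<open>U\<close>, and the measures of all shells have a finite sum.\<close>

theorem hausdorff_measure_open_split:
  assumes "open U"
  shows "hausdorff_measure k (E \<inter> U) + hausdorff_measure k (E - U) \<le> hausdorff_measure k E"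
\<comment> \<open>Two degenerate cases: for \<open>U = UNIV\<close> the distance to the empty
  complement is 0 by default, and an infinite measure of \<open>E\<close> would prevent the
  cancellation at the end.\<close>
proof (cases "U = UNIV \<or> hausdorff_measure k E = top")
  case True
  then show ?thesis by auto
next
  case False
  let ?\<mu> = "hausdorff_measure k"
  define f where "f x = infdist x (- U)" for x
  define a where "a j = inverse (real (Suc j))" for j
  define shell where "shell j = {x \<in> E \<inter> U. a (Suc (Suc j)) < f x \<and> f x \<le> a (Suc j)}" for j
  define core where "core j = {x \<in> E \<inter> U. a (Suc j) < f x}" for j
  have ne: "- U \<noteq> {}" and fin: "?\<mu> E < top"
    using False by (auto simp: less_top)
  have f_pos: "f x > 0" if "x \<in> U" for x
    using that assms in_closed_iff_infdist_zero[of "- U" x] ne infdist_nonneg[of x "- U"]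
    unfolding f_def by (simp add: closed_Compl less_le)
  have f_lip: "f x - f y \<le> dist x y" for x y
    unfolding f_def using infdist_triangle[of x "- U" y] by simp
  have a_less: "a j < a i" if "i < j" for i j
    using that by (simp add: a_def)
  have a_le: "a j \<le> a i" if "i \<le> j" for i j
    using that by (simp add: a_def)
  have a_pos: "a j > 0" for j
    by (simp add: a_def)

  \<comment> \<open>Shells whose indices differ by at least 2 have positive distance, so the measures of the even
    and of the odd shells each add up to at most that of \<open>E\<close>.\<close>
  have alternate: "(\<Sum>j<m. ?\<mu> (shell (2 * j + p))) \<le> ?\<mu> (\<Union>j<m. shell (2 * j + p))" for m p
  proof (induction m)
    case (Suc m)
    have step: "?\<mu> (\<Union>j<m. shell (2 * j + p)) + ?\<mu> (shell (2 * m + p))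
        \<le> ?\<mu> ((\<Union>j<m. shell (2 * j + p)) \<union> shell (2 * m + p))"
    proof (rule hausdorff_measure_separated)
      \<comment> \<open>Points of the earlier shells have \<open>f\<close> greater than
        \<open>a (2 * m + p)\<close>, those of the new one at most
        \<open>a (Suc (2 * m + p))\<close>. The skipped shell provides the gap.\<close>
      show "0 < a (2 * m + p) - a (Suc (2 * m + p))"
        using a_less[of "2 * m + p" "Suc (2 * m + p)"] by simp
      fix x y assume "x \<in> (\<Union>j<m. shell (2 * j + p))" and y: "y \<in> shell (2 * m + p)"
      then obtain j where j: "j < m" "a (Suc (Suc (2 * j + p))) < f x"
        by (auto simp: shell_def)
      moreover have "a (2 * m + p) \<le> a (Suc (Suc (2 * j + p)))"
        using j(1) by (intro a_le) auto
      ultimately show "a (2 * m + p) - a (Suc (2 * m + p)) \<le> dist x y"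
        using y f_lip[of x y] by (simp add: shell_def)
    qed
    have "(\<Union>j<m. shell (2 * j + p)) \<union> shell (2 * m + p) = (\<Union>j<Suc m. shell (2 * j + p))"
      by (auto simp: lessThan_Suc)
    then show ?case
      unfolding sum.lessThan_Suc using order_trans[OF add_right_mono[OF Suc] step] by metis
  qed simp
  have alternate_E: "(\<Sum>j<m. ?\<mu> (shell (2 * j + p))) \<le> ?\<mu> E" for m p
    by (rule order_trans[OF alternate hausdorff_measure_mono]) (auto simp: shell_def)
  have "(\<Sum>j<m. ?\<mu> (shell j)) \<le> ?\<mu> E + ?\<mu> E" for m
  proof -
    have "(\<Sum>j<m. ?\<mu> (shell j)) \<le> (\<Sum>j<2 * m. ?\<mu> (shell j))"
      by (rule sum_mono2) auto
    also have "\<dots> = (\<Sum>j<m. ?\<mu> (shell (2 * j + 0))) + (\<Sum>j<m. ?\<mu> (shell (2 * j + 1)))"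
      by (induction m) (auto simp: ac_simps)
    also have "\<dots> \<le> ?\<mu> E + ?\<mu> E"
      by (intro add_mono alternate_E)
    finally show ?thesis .
  qed
  then have "(\<Sum>j. ?\<mu> (shell j)) \<le> ?\<mu> E + ?\<mu> E"
    unfolding suminf_eq_SUP by (intro SUP_least) auto
  then have S_fin: "(\<Sum>j. ?\<mu> (shell j)) < top"
    using fin by (elim le_less_trans) simp

  have cover: "E \<inter> U \<subseteq> core N \<union> (\<Union>j. shell (j + N))" for N
  proof
    fix x assume x: "x \<in> E \<inter> U"
    show "x \<in> core N \<union> (\<Union>j. shell (j + N))"
    proof (cases "a (Suc N) < f x")
      case True
      then show ?thesis using x by (simp add: core_def)
    next
      case False
      \<comment> \<open>Minimality of \<open>i\<close> gives the upper bound in the definition of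
        the shell. Outside \<open>core N\<close> the index is at least \<open>N + 2\<close>, which
        makes the shift by 2 possible.\<close>
      define i where "i = (LEAST i. a i < f x)"
      have "\<exists>i. a i < f x"
        unfolding a_def using reals_Archimedean[of "f x"] f_pos x by blast
      then have i: "a i < f x"
        unfolding i_def by (rule LeastI_ex)
      then have "i > Suc N"
        using False a_le[of i "Suc N"] by (meson not_le_imp_less order.strict_trans1)
      then obtain j where j: "i = Suc (Suc (j + N))"
        by (metis add.commute add_Suc less_iff_Suc_add)
      have "\<not> a (Suc (j + N)) < f x"
        using not_less_Least[of "Suc (j + N)" "\<lambda>i. a i < f x"] j by (simp add: i_def)
      then have "x \<in> shell (j + N)"
        using x i j by (simp add: shell_def)
      then show ?thesis by blast
    qed
  qed
  let ?T = "?\<mu> (E \<inter> U) + ?\<mu> (E - U)"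
  \<comment> \<open>Adding the first \<open>N\<close> shells completes the tail to the full series.
    The right-hand side is then independent of \<open>N\<close>, and the supremum over
    \<open>N\<close> replaces a limit of tails; the finite series cancels afterwards.\<close>
  have "?T + (\<Sum>j<N. ?\<mu> (shell j)) \<le> ?\<mu> E + (\<Sum>j. ?\<mu> (shell j))" for N
  proof -
    have "?\<mu> (E \<inter> U) \<le> ?\<mu> (core N) + ?\<mu> (\<Union>j. shell (j + N))"
      by (rule order_trans[OF hausdorff_measure_mono[OF cover] hausdorff_measure_Un_le])
    also have "\<dots> \<le> ?\<mu> (core N) + (\<Sum>j. ?\<mu> (shell (j + N)))"
      by (intro add_mono hausdorff_measure_UN_le order_refl)
    finally have 1: "?\<mu> (E \<inter> U) \<le> ?\<mu> (core N) + (\<Sum>j. ?\<mu> (shell (j + N)))" .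
    have "?\<mu> (core N) + ?\<mu> (E - U) \<le> ?\<mu> (core N \<union> (E - U))"
    proof (rule hausdorff_measure_separated[OF a_pos[of "Suc N"]])
      fix x y assume "x \<in> core N" "y \<in> E - U"
      then show "a (Suc N) \<le> dist x y"
        using infdist_le[of y "- U" x] by (simp add: core_def f_def)
    qed
    also have "\<dots> \<le> ?\<mu> E"
      by (rule hausdorff_measure_mono) (auto simp: core_def)
    finally have 2: "?\<mu> (core N) + ?\<mu> (E - U) \<le> ?\<mu> E" .
    have 3: "(\<Sum>j. ?\<mu> (shell j)) = (\<Sum>j. ?\<mu> (shell (j + N))) + (\<Sum>j<N. ?\<mu> (shell j))"
      by (rule suminf_offset) auto
    have "?T + (\<Sum>j<N. ?\<mu> (shell j))
        \<le> (?\<mu> (core N) + (\<Sum>j. ?\<mu> (shell (j + N)))) + ?\<mu> (E - U) + (\<Sum>j<N. ?\<mu> (shell j))"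
      by (intro add_right_mono 1)
    also have "\<dots> = (?\<mu> (core N) + ?\<mu> (E - U)) + (\<Sum>j. ?\<mu> (shell j))"
      unfolding 3 by (simp add: ac_simps)
    also have "\<dots> \<le> ?\<mu> E + (\<Sum>j. ?\<mu> (shell j))"
      by (intro add_right_mono 2)
    finally show ?thesis .
  qed
  then have "?T + (\<Sum>j. ?\<mu> (shell j)) \<le> ?\<mu> E + (\<Sum>j. ?\<mu> (shell j))"
    unfolding suminf_eq_SUP[of "\<lambda>j. ?\<mu> (shell j)"]
      ennreal_SUP_add_right[OF UNIV_not_empty]
    by (intro SUP_least)
  then show ?thesis
    using S_fin by auto
qed

text \<open>The pieces are peeled off one by one. After removal of \<open>U\<close> the others,
  being disjoint from \<open>B i\<close>, are still relatively open in \<open>E - U\<close>; hence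
  the induction over arbitrary \<open>E\<close>.\<close>

lemma sum_hausdorff_measure_openin_le:
  assumes "finite I" and "\<And>i. i \<in> I \<Longrightarrow> openin (top_of_set E) (B i)"
    and "disjoint_family_on B I"
  shows "(\<Sum>i\<in>I. hausdorff_measure k (B i)) \<le> hausdorff_measure k E"
  using assms
proof (induction I arbitrary: E)
  case (insert i I)
  obtain U where U: "open U" "B i = E \<inter> U"
    using insert.prems(1) by (auto simp: openin_open)
  have "(\<Sum>j\<in>I. hausdorff_measure k (B j)) \<le> hausdorff_measure k (E - U)"
  proof (rule insert.IH)
    show "disjoint_family_on B I"
      using insert.prems(2) by (auto simp: disjoint_family_on_def)
    fix j assume j: "j \<in> I"
    then have op: "openin (top_of_set E) (B j)"
      using insert.prems(1) by simp
    have "B i \<inter> B j = {}"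
      using insert.prems(2) insert.hyps(2) j by (auto simp: disjoint_family_on_def)
    then have "B j \<subseteq> E - U"
      using openin_imp_subset[OF op] U(2) by auto
    then show "openin (top_of_set (E - U)) (B j)"
      by (rule openin_subset_trans[OF op]) auto
  qed
  then have "(\<Sum>j\<in>insert i I. hausdorff_measure k (B j))
      \<le> hausdorff_measure k (E \<inter> U) + hausdorff_measure k (E - U)"
    using insert.hyps U(2) by (simp add: add_left_mono)
  also have "\<dots> \<le> hausdorff_measure k E"
    by (rule hausdorff_measure_open_split[OF U(1)])
  finally show ?case .
qed simp


section \<open>Partitions and homologous hypersurfaces\<close>

lemma area_mono: "X \<subseteq> Y \<Longrightarrow> area M X \<le> area M Y"
  unfolding area_def by (rule hausdorff_measure_mono)

lemma area_Un_le: "area M (X \<union> Y) \<le> area M X + area M Y"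
  unfolding area_def by (rule hausdorff_measure_Un_le)

text \<open>A region differs from its relative interior only by frontier points, which have zero
  area.\<close>

lemma area_region_of_le_interior:
  assumes "region_of M X R"
  shows "area M R \<le> area M ((top_of_set X) interior_of R)"
proof -
  have "(top_of_set X) closure_of ((top_of_set X) interior_of R) \<subseteq> (top_of_set X) closure_of R"
    by (intro closure_of_mono interior_of_subset)
  then have "R \<subseteq> (top_of_set X) interior_of R \<union> (top_of_set X) frontier_of R"
    using assms by (auto simp: region_of_def frontier_of_def)
  then have "area M R
      \<le> area M ((top_of_set X) interior_of R) + area M ((top_of_set X) frontier_of R)"
    by (rule order_trans[OF area_mono area_Un_le])
  then show ?thesis
    using assms by (simp add: region_of_def)
qed

lemma sum_area_region_partition_le:
  assumes "region_partition M n X A'"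
  shows "(\<Sum>i\<in>{1..n}. area M (A' i)) \<le> area M X"
proof -
  \<comment> \<open>Only the interiors are disjoint, and they are relatively open, so the open
    splitting applies to them.\<close>
  have "(\<Sum>i\<in>{1..n}. area M (A' i)) \<le> (\<Sum>i\<in>{1..n}. area M ((top_of_set X) interior_of (A' i)))"
    using assms by (intro sum_mono area_region_of_le_interior) (simp add: region_partition_def)
  also have "\<dots> \<le> area M X"
    unfolding area_def using assms
    by (intro sum_hausdorff_measure_openin_le) (auto simp: region_partition_def)
  finally show ?thesis .
qed

section \<open>Homologous and minimal hypersurfaces\<close>

lemma homologous_refl: "homologous M N R R"
  unfolding homologous_def
  by (rule exI[of _ "{}"]) (simp add: bounded_by_def region_def region_boundary_def)

lemma homologous_mono: "homologous M N R m \<Longrightarrow> N \<subseteq> N' \<Longrightarrow> homologous M N' R m"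
  unfolding homologous_def by (elim exE conjE) (rule exI, erule conjI[OF subset_trans], assumption+)

text \<open>The whole manifold is the bounding region. Together with \<open>homologous_refl\<close>
  this gives two explicit competitors for every \<open>R\<close>.\<close>

lemma homologous_complement: "homologous M (points M) R (sym_diff (boundary M \<inter> points M) R)"
proof -
  have "region M (points M)"
    by (simp add: region_def interior_of_topspace[of "top_of_set (points M)", simplified]
        closure_of_topspace[of "top_of_set (points M)", simplified])
  moreover have "region_boundary M (points M) = boundary M \<inter> points M"
    using frontier_of_topspace[of "top_of_set (points M)"]
    by (auto simp: region_boundary_def)
  ultimately show ?thesis
    by (auto simp: homologous_def bounded_by_def intro!: exI[of _ "points M"])
qed

text \<open>Addition modulo 2 is associative, so the same bounding region serves on both
  sides.\<close>

lemma homologous_sym_diff_move: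
  "homologous M N (sym_diff R R') m \<longleftrightarrow> homologous M N R (sym_diff R' m)"
proof -
  have "sym_diff (sym_diff R R') m = sym_diff R (sym_diff R' m)" by auto
  then show ?thesis by (simp add: homologous_def bounded_by_def)
qed

lemma ennreal_le_add_INF:
  fixes f :: "'i \<Rightarrow> ennreal"
  assumes "\<And>i. i \<in> I \<Longrightarrow> x \<le> c + f i"
  shows "x \<le> c + (INF i\<in>I. f i)"
proof (cases "c = top")
  case False
  then have "x - c \<le> (INF i\<in>I. f i)"
    using assms by (intro INF_greatest) (simp add: ennreal_minus_le_iff)
  then show ?thesis
    using False by (simp add: ennreal_minus_le_iff)
qed simp

text \<open>Adding \<open>R'\<close> to a competitor for \<open>sym_diff R R'\<close> gives one for
  \<open>R\<close>, at the cost of at most the area of \<open>R'\<close>.\<close>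

lemma min_area_sym_diff_le:
  assumes "N \<subseteq> N'"
  shows "min_area M N' R \<le> area M R' + min_area M N (sym_diff R R')"
proof -
  have "min_area M N' R \<le> area M R' + area M m" if "homologous M N (sym_diff R R') m" for m
  proof -
    have "homologous M N' R (sym_diff R' m)"
      using that assms unfolding homologous_sym_diff_move by (rule homologous_mono)
    then have "min_area M N' R \<le> area M (sym_diff R' m)"
      unfolding min_area_def by (intro INF_lower) simp
    also have "\<dots> \<le> area M R' + area M m"
      by (rule order_trans[OF area_mono area_Un_le]) auto
    finally show ?thesis .
  qed
  then show ?thesis
    unfolding min_area_def[of M N "sym_diff R R'"] by (intro ennreal_le_add_INF) simp
qed

lemma unique_minimal_hypersurface_finite_area:
  assumes "R \<subseteq> boundary M" and "boundary M \<subseteq> points M"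
    and min: "minimal_hypersurface M (points M) R X"
    and unique: "\<And>m. minimal_hypersurface M (points M) R m \<Longrightarrow> m = X"
  shows "area M X < top"
proof (rule ccontr)
  assume "\<not> area M X < top"
  then have inf: "min_area M (points M) R = top"
    using min by (simp add: minimal_hypersurface_def flip: less_top)
  have eq: "m = X" if "homologous M (points M) R m" for m
  proof -
    have "min_area M (points M) R \<le> area M m"
      unfolding min_area_def using that by (intro INF_lower) simp
    then show ?thesis
      using that inf by (intro unique) (simp add: minimal_hypersurface_def top_unique)
  qed
  \<comment> \<open>Uniqueness identifies \<open>R\<close> with its complement in the boundary,
    which forces both to be empty; but the empty set has area 0.\<close>
  have "R = X" "sym_diff (boundary M \<inter> points M) R = X"
    by (intro eq homologous_refl homologous_complement)+
  then have "X = {}"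
    using assms(1,2) by blast
  then show False
    using \<open>\<not> area M X < top\<close> by (simp add: area_def)
qed

section \<open>The inequality for the cross section\<close>

text \<open>The additive form of the inequality, which avoids the truncated subtraction of
  \<open>ennreal\<close>. It holds for each partition separately and hence for the infimum.\<close>

theorem sum_RT_entropy_le:
  assumes "r \<subseteq> points M"
  shows "(\<Sum>i\<in>{1..n}. RT_entropy M (A i)) \<le> area M X + cross_section M n A r X"
proof -
  have "(\<Sum>i\<in>{1..n}. RT_entropy M (A i))
      \<le> area M X + (\<Sum>i\<in>{1..n}. min_area M r (sym_diff (A i) (A' i)))"
    if "region_partition M n X A'" for A'
  proof -
    have "(\<Sum>i\<in>{1..n}. RT_entropy M (A i))
        \<le> (\<Sum>i\<in>{1..n}. area M (A' i) + min_area M r (sym_diff (A i) (A' i)))"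
      unfolding RT_entropy_def using assms by (intro sum_mono min_area_sym_diff_le)
    also have "\<dots> \<le> area M X + (\<Sum>i\<in>{1..n}. min_area M r (sym_diff (A i) (A' i)))"
      unfolding sum.distrib by (intro add_right_mono sum_area_region_partition_le that)
    finally show ?thesis .
  qed
  then show ?thesis
    unfolding cross_section_def by (intro ennreal_le_add_INF) simp
qed

theorem mainTheorem6:
  fixes M :: "('a::metric_space, 'n::finite) rmanifold"
    and n :: nat and A :: "nat \<Rightarrow> 'a set" and \<O> r :: "'a set"
  assumes "compact_riemannian_manifold M"
    and "\<And>i. i \<in> {1..n} \<Longrightarrow> region_of M (boundary M) (A i)"
    and "disjoint_family_on A {1..n}"
    and "minimal_hypersurface M (points M) (\<Union>i\<in>{1..n}. A i) \<O>"
    and "\<And>m. minimal_hypersurface M (points M) (\<Union>i\<in>{1..n}. A i) m \<Longrightarrow> m = \<O>"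
    and "bounded_by M r (\<Union>i\<in>{1..n}. A i) \<O>"
    and "cross_section M n A r \<O> = relaxed_cross_section M n A r \<O>"
  shows "enn2ereal (cross_section M n A r \<O>) \<ge> multi_information M n A"
proof -
  have "smooth_atlas M"
    using assms(1) by (simp add: compact_riemannian_manifold_def)
  then have "boundary M \<subseteq> points M"
    by (fastforce simp: boundary_def smooth_atlas_def)
  moreover have "(\<Union>i\<in>{1..n}. A i) \<subseteq> boundary M"
    using assms(2) unfolding region_of_def by blast
  ultimately have fin: "area M \<O> < top"
    using assms(4,5) by (intro unique_minimal_hypersurface_finite_area)
  have S: "RT_entropy M (\<Union>i\<in>{1..n}. A i) = area M \<O>"
    using assms(4) by (simp add: RT_entropy_def minimal_hypersurface_def)
  have "r \<subseteq> points M"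
    using assms(6) by (simp add: bounded_by_def region_def)
  then have "(\<Sum>i\<in>{1..n}. RT_entropy M (A i)) \<le> area M \<O> + cross_section M n A r \<O>"
    by (rule sum_RT_entropy_le)
  moreover have "(\<Sum>i\<in>{1..n}. enn2ereal (RT_entropy M (A i)))
      = enn2ereal (\<Sum>i\<in>{1..n}. RT_entropy M (A i))"
    by (rule sum_enn2ereal) simp
  ultimately have le: "(\<Sum>i\<in>{1..n}. enn2ereal (RT_entropy M (A i)))
      \<le> enn2ereal (cross_section M n A r \<O>) + enn2ereal (area M \<O>)"
    by (simp only: less_eq_ennreal.rep_eq plus_ennreal.rep_eq add.commute)
  \<comment> \<open>With a finite subtrahend, the term can be moved across the inequality in
    \<open>ereal\<close>.\<close>
  have "enn2ereal (area M \<O>) \<noteq> \<infinity>" "enn2ereal (area M \<O>) \<noteq> - \<infinity>"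
    using fin enn2ereal_nonneg[of "area M \<O>"] by auto
  then show ?thesis
    unfolding multi_information_def S ereal_minus_le_iff using le by blast
qed

end
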